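(* Let $D\subset\mathbb{C}$ be a circular domain and let $q\in\mathbb{C}[z]$ be a monic polynomial of degree $d$. Let $f,g\in\mathbb{C}[z]$ be polynomials of the same degree $n$ which are $q$-apolar, i.e. $[f\circ q,g\circ q]_{nd}=0$. If all zeros of $f$ lie in $q_\circ(D)$, then $g$ has at least one zero in $q(D)$.
   Context: A circular domain is an open or closed disk or halfspace (half-plane) in $\mathbb{C}$, or the complement of any such set. For a polynomial $q$ and a set $D\subset\mathbb{C}$, $q(D)$ is the image of $D$ under $q\colon\mathbb{C}\to\mathbb{C}$, and $q_\circ(D)=\{u\in\mathbb{C} : q^{-1}(u)\subset D\}$. $\mathbb{C}[z]_m$ is the space of complex polynomials of degree at most $m$. For $f=\sum_{k=0}^m a_kz^k$ and $g=\sum_{k=0}^m b_kz^k$ in $\mathbb{C}[z]_m$, the apolarity form is the bilinear form $[f,g]_m=\sum_{k=0}^m \frac{(-1)^{m-k}}{\binom{m}{k}}a_kb_{m-k}\cdot(-1)^m=\sum_{k=0}^m\frac{(-1)^k}{\binom{m}{k}}a_kb_{m-k}$. Two polynomials $f,g\in\mathbb{C}[z]_n$ are called $q$-apolar if $[f\circ q,g\circ q]_{nd}=0$, where $d=\deg q$. *)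

theory Defs
  imports "HOL-Analysis.Analysis" "HOL-Computational_Algebra.Polynomial"
begin

text \<open>Degenerate disks (empty or a single point) are excluded by \<open>r > 0\<close>. On the complex
  numbers \<open>inner a z = Re (cnj a * z)\<close>.\<close>

definition disk_or_halfplane :: "complex set \<Rightarrow> bool" where
  "disk_or_halfplane E \<longleftrightarrow>
     (\<exists>c r. r > 0 \<and> (E = ball c r \<or> E = cball c r)) \<or>
     (\<exists>a b. a \<noteq> 0 \<and> (E = {z. inner a z < b} \<or> E = {z. inner a z \<le> b}))"

definition circular_domain :: "complex set \<Rightarrow> bool" where
  "circular_domain D \<longleftrightarrow> (\<exists>E. disk_or_halfplane E \<and> (D = E \<or> D = - E))"

text \<open>The set \<open>q\<^sub>\<circ>(D)\<close> of values whose full preimage under \<open>q\<close> lies in \<open>D\<close>.\<close>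

definition inner_image :: "complex poly \<Rightarrow> complex set \<Rightarrow> complex set" where
  "inner_image q D = {u. poly q -` {u} \<subseteq> D}"

definition apolarity_form :: "nat \<Rightarrow> complex poly \<Rightarrow> complex poly \<Rightarrow> complex" where
  "apolarity_form m f g =
     (\<Sum>k\<le>m. (- 1) ^ k / of_nat (m choose k) * coeff f k * coeff g (m - k))"

text \<open>The index \<open>n\<close> is the degree bound of the ambient space containing both polynomials;
  the form is taken in degree \<open>n * degree q\<close>, whatever the degrees of \<open>f\<close> and \<open>g\<close>.\<close>

definition q_apolar :: "nat \<Rightarrow> complex poly \<Rightarrow> complex poly \<Rightarrow> complex poly \<Rightarrow> bool" where
  "q_apolar n q f g \<longleftrightarrow> degree f \<le> n \<and> degree g \<le> n \<and>
     apolarity_form (n * degree q) (pcompose f q) (pcompose g q) = 0"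

end

(* Composing with q reduces the claim to Grace's theorem for f o q and g o q in degree n d.
   For a root w of g one has [f, (X - w) g']_(m+1) = [A_w f, g']_m / (m+1), where
   A_w f = (m+1) f + (w - X) f' is the polar derivative, and Laguerre's theorem says that A_w
   keeps the roots in a disk or half-plane E not containing w.  Splitting off the roots of g one
   by one, the form ends in a product of nonzero constants.  The form is symmetric up to sign, so
   when D is the complement of E one exchanges f and g; hence E may always be taken convex and
   the point at infinity never enters. *)
theory Submission
  imports Defs "HOL-Computational_Algebra.Fundamental_Theorem_Algebra"
begin

section \<open>Quadratic sublevel sets and inversion\<close>

text \<open>Treats both shapes at once: disks arise with \<open>A = 1\<close>, half-planes with
  \<open>A = 0\<close>, and inversion preserves the family.\<close>

definition quad :: "real \<Rightarrow> 'a::real_inner \<Rightarrow> real \<Rightarrow> 'a \<Rightarrow> real" where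
  "quad A B C x = A * (norm x)\<^sup>2 + inner B x + C"

lemma quad_convex:
  assumes "A \<ge> 0" "s \<ge> 0" "t \<ge> 0" "s + t = 1"
  shows "quad A B C (s *\<^sub>R x + t *\<^sub>R y) \<le> s * quad A B C x + t * quad A B C y"
proof -
  have s: "s = 1 - t" using assms by simp
  have "s * quad A B C x + t * quad A B C y - quad A B C (s *\<^sub>R x + t *\<^sub>R y)
      = A * (s * t * (norm (x - y))\<^sup>2)"
    unfolding quad_def power2_norm_eq_inner s
    by (simp add: inner_simps inner_commute[of y x] algebra_simps)
  also have "\<dots> \<ge> 0" using assms by simp
  finally show ?thesis by simp
qed

definition quad_sublevel :: "bool \<Rightarrow> real \<Rightarrow> 'a::real_inner \<Rightarrow> real \<Rightarrow> 'a set" where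
  "quad_sublevel strict A B C =
     {x. if strict then quad A B C x < 0 else quad A B C x \<le> 0}"

lemma convex_quad_sublevel:
  assumes "A \<ge> 0"
  shows "convex (quad_sublevel strict A B C)"
proof (rule convexI)
  fix x y :: 'a and s t :: real
  assume x: "x \<in> quad_sublevel strict A B C" and y: "y \<in> quad_sublevel strict A B C"
    and st: "0 \<le> s" "0 \<le> t" "s + t = 1"
  note le = quad_convex[OF assms st, of B C x y]
  have "s * quad A B C x + t * quad A B C y < 0" if strict
    using convex_bound_lt[of "quad A B C x" 0 "quad A B C y" s t] x y st that
    by (simp add: quad_sublevel_def)
  moreover have "s * quad A B C x + t * quad A B C y \<le> 0" if "\<not> strict"
    using convex_bound_le[of "quad A B C x" 0 "quad A B C y" s t] x y st that
    by (simp add: quad_sublevel_def)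
  ultimately show "s *\<^sub>R x + t *\<^sub>R y \<in> quad_sublevel strict A B C"
    using le by (auto simp: quad_sublevel_def)
qed

text \<open>Since \<open>inverse u\<close> is \<open>cnj u\<close> over the squared norm, clearing
  the denominator makes the value at \<open>z\<close> the new leading coefficient and
  \<open>A\<close> the new constant term. A value >= 0 at \<open>z\<close> thus makes the inverted
  region convex.\<close>

lemma quad_inversion:
  fixes z u B :: complex
  assumes "u \<noteq> 0"
  shows "(norm u)\<^sup>2 * quad A B C (z - inverse u)
    = quad (quad A B C z) (- cnj ((2 * A) *\<^sub>R z + B)) A u"
proof -
  have n: "(norm u)\<^sup>2 \<noteq> 0" using assms by simp
  have inv: "inverse u = (1 / (norm u)\<^sup>2) *\<^sub>R cnj u"
    using assms by (simp add: complex_eq_iff cmod_power2)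
  have cn: "inner v (cnj u) = inner (cnj v) u" for v
    by (simp add: inner_complex_def)
  have sq: "(norm (inverse u))\<^sup>2 = 1 / (norm u)\<^sup>2"
    by (simp add: inverse_eq_divide norm_divide power_divide)
  have "quad A B C (z - inverse u)
      = A * ((norm z)\<^sup>2 - 2 * inner z (inverse u) + (norm (inverse u))\<^sup>2)
        + inner B z - inner B (inverse u) + C"
    unfolding quad_def power2_norm_eq_inner
    by (simp add: inner_simps inner_commute[of "inverse u" z] algebra_simps)
  also have "\<dots> = quad A B C z
      + (A - 2 * A * inner (cnj z) u - inner (cnj B) u) / (norm u)\<^sup>2"
    unfolding sq unfolding inv inner_scaleR_right cn quad_def
    by (simp add: algebra_simps diff_divide_distrib add_divide_distrib)
  finally show ?thesis
    using n by (simp add: quad_def[of "quad A B C z"] field_simps inner_simps)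
qed

text \<open>The set \<open>inverse u \<in> z - E\<close> of points \<open>u\<close> is, up to \<open>u = 0\<close>, again convex
  because \<open>quad A B C z \<ge> 0\<close>.\<close>

lemma inversion_hull_quad_sublevel:
  fixes z w B :: complex and A C :: real and strict :: bool
  defines "E \<equiv> quad_sublevel strict A B C"
  assumes "A \<ge> 0" and z: "z \<notin> E" and w: "w \<notin> E" and "z \<noteq> w"
  shows "inverse (z - w) \<notin> convex hull ((\<lambda>x. inverse (z - x)) ` E)"
proof
  define S where "S = quad_sublevel strict (quad A B C z) (- cnj ((2 * A) *\<^sub>R z + B)) A"
  have Qz: "quad A B C z \<ge> 0"
    using z by (auto simp: E_def quad_sublevel_def split: if_splits)
  \<comment> \<open>Whether 0 lies in \<open>S\<close> is irrelevant: only nonzero points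
    \<open>inverse (z - x)\<close> are tested.\<close>
  have S_iff: "u \<in> S \<longleftrightarrow> z - inverse u \<in> E" if "u \<noteq> 0" for u
  proof -
    have "(norm u)\<^sup>2 > 0" using that by simp
    then show ?thesis
      unfolding S_def E_def quad_sublevel_def mem_Collect_eq quad_inversion[OF that, symmetric]
      by (simp add: mult_less_0_iff mult_le_0_iff)
  qed
  have "(\<lambda>x. inverse (z - x)) ` E \<subseteq> S"
  proof safe
    fix x assume "x \<in> E"
    with z have "z - x \<noteq> 0" by auto
    with \<open>x \<in> E\<close> show "inverse (z - x) \<in> S" by (simp add: S_iff)
  qed
  then have "convex hull ((\<lambda>x. inverse (z - x)) ` E) \<subseteq> S"
    using convex_quad_sublevel[OF Qz] unfolding S_def by (intro hull_minimal)
  moreover assume "inverse (z - w) \<in> convex hull ((\<lambda>x. inverse (z - x)) ` E)"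
  ultimately have "inverse (z - w) \<in> S" by blast
  with \<open>z \<noteq> w\<close> w show False by (simp add: S_iff)
qed

section \<open>Disks, half-planes and circular domains\<close>

lemma disk_or_halfplane_quad_sublevel:
  assumes "disk_or_halfplane E"
  obtains strict A B C where "A \<ge> 0" "E = quad_sublevel strict A B C"
proof -
  have disk: "quad 1 (- (2 *\<^sub>R c)) ((norm c)\<^sup>2 - r\<^sup>2) x = (dist c x)\<^sup>2 - r\<^sup>2" for c x :: complex and r
    unfolding quad_def dist_norm power2_norm_eq_inner
    by (simp add: inner_simps inner_commute[of x c] algebra_simps)
  consider (ball) c r where "r > 0" "E = ball c r" | (cball) c r where "r > 0" "E = cball c r"
    | (open_half) a b where "E = {z. inner a z < b}" | (closed_half) a b where "E = {z. inner a z \<le> b}"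
    using assms unfolding disk_or_halfplane_def by blast
  then show thesis
  proof cases
    case ball
    have "(dist c x)\<^sup>2 - r\<^sup>2 < 0 \<longleftrightarrow> dist c x < r" for x
      using ball(1) by (auto intro: power_strict_mono power2_less_imp_less)
    then have "E = quad_sublevel True 1 (- (2 *\<^sub>R c)) ((norm c)\<^sup>2 - r\<^sup>2)"
      by (simp add: ball(2) quad_sublevel_def disk ball_def del: diff_less_0_iff_less)
    then show thesis by (intro that[of 1]) auto
  next
    case cball
    have "(dist c x)\<^sup>2 - r\<^sup>2 \<le> 0 \<longleftrightarrow> dist c x \<le> r" for x
      using cball(1) by (auto intro: power_mono power2_le_imp_le)
    then have "E = quad_sublevel False 1 (- (2 *\<^sub>R c)) ((norm c)\<^sup>2 - r\<^sup>2)"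
      by (simp add: cball(2) quad_sublevel_def disk cball_def del: diff_le_0_iff_le)
    then show thesis by (intro that[of 1]) auto
  next
    case open_half
    then have "E = quad_sublevel True 0 a (- b)"
      by (auto simp: quad_sublevel_def quad_def)
    then show thesis by (intro that[of 0]) auto
  next
    case closed_half
    then have "E = quad_sublevel False 0 a (- b)"
      by (auto simp: quad_sublevel_def quad_def)
    then show thesis by (intro that[of 0]) auto
  qed
qed

text \<open>Excludes the zero polynomial later on: every point is a root of it, so its roots lie
  neither all in \<open>D\<close> nor all outside \<open>D\<close>.\<close>

lemma circular_domain_proper:
  assumes "circular_domain D"
  shows "D \<noteq> {}" and "D \<noteq> UNIV"
proof -
  obtain E where E: "disk_or_halfplane E" "D = E \<or> D = - E"
    using assms unfolding circular_domain_def by blast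
  \<comment> \<open>The functional \<open>inner a\<close> takes any prescribed value on multiples of
    \<open>a\<close>; values on both sides of the threshold supply a member and a
    non-member.\<close>
  have half: "inner a ((b / (norm a)\<^sup>2) *\<^sub>R a) = b" if "a \<noteq> 0" for a :: complex and b
    using that by (simp add: power2_norm_eq_inner)
  have "E \<noteq> {} \<and> E \<noteq> UNIV"
    using E(1) unfolding disk_or_halfplane_def
  proof (elim disjE exE conjE)
    fix a :: complex and b :: real
    assume a: "a \<noteq> 0" and "E = {z. inner a z < b}"
    then have "((b - 1) / (norm a)\<^sup>2) *\<^sub>R a \<in> E" "(b / (norm a)\<^sup>2) *\<^sub>R a \<notin> E"
      using half[OF a] by (simp_all only: mem_Collect_eq)
    then show "E \<noteq> {} \<and> E \<noteq> UNIV" by blast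
  next
    fix a :: complex and b :: real
    assume a: "a \<noteq> 0" and "E = {z. inner a z \<le> b}"
    then have "(b / (norm a)\<^sup>2) *\<^sub>R a \<in> E" "((b + 1) / (norm a)\<^sup>2) *\<^sub>R a \<notin> E"
      using half[OF a] by (simp_all only: mem_Collect_eq)
    then show "E \<noteq> {} \<and> E \<noteq> UNIV" by blast
  next
    fix c :: complex and r :: real
    assume "r > 0" "E = ball c r"
    then show "E \<noteq> {} \<and> E \<noteq> UNIV"
      using bounded_ball[of c r] not_bounded_UNIV[where 'a = complex] by (metis centre_in_ball empty_iff)
  next
    fix c :: complex and r :: real
    assume "r > 0" "E = cball c r"
    then show "E \<noteq> {} \<and> E \<noteq> UNIV"
      using bounded_cball[of c r] not_bounded_UNIV[where 'a = complex]
      by (metis cball_eq_empty less_le_not_le)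
  qed
  then show "D \<noteq> {}" "D \<noteq> UNIV" using E(2) by auto
qed

section \<open>Laguerre's theorem\<close>

lemma complex_poly_split_root:
  fixes f :: "complex poly"
  assumes "degree f = Suc m"
  obtains w h where "f = [:- w, 1:] * h" "degree h = m" "poly f w = 0"
proof -
  obtain w where w: "poly f w = 0"
    using fundamental_theorem_of_algebra[of f] assms by (auto simp: constant_degree)
  then obtain h where h: "f = [:- w, 1:] * h"
    using poly_eq_0_iff_dvd[of f w] by (auto elim: dvdE)
  with assms have "h \<noteq> 0" by auto
  then have "degree f = Suc (degree h)"
    unfolding h by (subst degree_mult_eq) auto
  with assms h w that show thesis by simp
qed

text \<open>Here \<open>y\<close> plays the sum of \<open>m + 1\<close> numbers; the new mean
  combines \<open>x\<close> and the old mean with weights \<open>1/(m+2)\<close> and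
  \<open>(m+1)/(m+2)\<close>.\<close>

lemma convex_average_step:
  fixes x y :: complex
  assumes "convex S" "x \<in> S" "y / of_nat (Suc m) \<in> S"
  shows "(x + y) / of_nat (Suc (Suc m)) \<in> S"
proof -
  define s :: real where "s = 1 / real (Suc (Suc m))"
  define t :: real where "t = real (Suc m) / real (Suc (Suc m))"
  have "s \<ge> 0" "t \<ge> 0" "s + t = 1" by (auto simp: s_def t_def field_simps)
  then have "s *\<^sub>R x + t *\<^sub>R (y / of_nat (Suc m)) \<in> S"
    using assms by (intro convexD)
  also have "s *\<^sub>R x + t *\<^sub>R (y / of_nat (Suc m)) = (x + y) / of_nat (Suc (Suc m))"
    by (simp add: s_def t_def scaleR_conv_of_real add_divide_distrib del: of_nat_Suc)
  finally show ?thesis .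
qed

text \<open>The logarithmic derivative is the sum of \<open>inverse (z - x)\<close> over the roots
  \<open>x\<close> with multiplicity, so the quotient is a mean of points of
  \<open>S\<close>.\<close>

lemma log_derivative_average:
  fixes f :: "complex poly"
  assumes "convex S" "degree f = Suc m" "poly f z \<noteq> 0"
    and "\<And>x. poly f x = 0 \<Longrightarrow> inverse (z - x) \<in> S"
  shows "poly (pderiv f) z / poly f z / of_nat (Suc m) \<in> S"
  using assms(2-)
proof (induction m arbitrary: f)
  case 0
  obtain w h where f: "f = [:- w, 1:] * h" "degree h = 0" "poly f w = 0"
    using complex_poly_split_root[OF 0(1)] .
  then obtain a where h: "h = [:a:]" by (metis degree_eq_zeroE)
  have "poly (pderiv f) z / poly f z / of_nat (Suc 0) = inverse (z - w)"
    using 0(2) by (simp add: f h pderiv_pCons field_simps)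
  then show ?case using 0(3)[OF f(3)] by simp
next
  case (Suc m)
  obtain w h where f: "f = [:- w, 1:] * h" "degree h = Suc m" "poly f w = 0"
    using complex_poly_split_root[OF Suc.prems(1)] .
  have "poly (pderiv h) z / poly h z / of_nat (Suc m) \<in> S"
    using Suc.prems(2,3) f by (intro Suc.IH) auto
  moreover have "poly (pderiv f) z = poly h z + (z - w) * poly (pderiv h) z"
    unfolding f(1) pderiv_mult by (simp add: pderiv_pCons algebra_simps)
  then have "poly (pderiv f) z / poly f z = inverse (z - w) + poly (pderiv h) z / poly h z"
    using Suc.prems(2) by (simp add: f(1) field_simps)
  ultimately show ?case
    using convex_average_step[OF assms(1) Suc.prems(3)[OF f(3)]] by (simp del: of_nat_Suc)
qed

text \<open>By Vieta the quotient is the mean of the roots with multiplicity.\<close>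

lemma centroid_average:
  fixes f :: "complex poly"
  assumes "convex S" "degree f = Suc m" "\<And>x. poly f x = 0 \<Longrightarrow> x \<in> S"
  shows "- coeff f m / coeff f (Suc m) / of_nat (Suc m) \<in> S"
  using assms(2-)
proof (induction m arbitrary: f)
  case 0
  obtain w h where f: "f = [:- w, 1:] * h" "degree h = 0" "poly f w = 0"
    using complex_poly_split_root[OF 0(1)] .
  then obtain a where h: "h = [:a:]" by (metis degree_eq_zeroE)
  have "a \<noteq> 0" using 0(1) by (auto simp: f h)
  then have "- coeff f 0 / coeff f (Suc 0) / of_nat (Suc 0) = w"
    by (simp add: f h)
  then show ?case using 0(2)[OF f(3)] by simp
next
  case (Suc m)
  obtain w h where f: "f = [:- w, 1:] * h" "degree h = Suc m" "poly f w = 0"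
    using complex_poly_split_root[OF Suc.prems(1)] .
  have "- coeff h m / coeff h (Suc m) / of_nat (Suc m) \<in> S"
    using Suc.prems(2) f by (intro Suc.IH) auto
  moreover have "- coeff f (Suc m) / coeff f (Suc (Suc m)) = w + - coeff h m / coeff h (Suc m)"
  proof -
    have "coeff h (Suc m) \<noteq> 0"
      using f(2) by (metis degree_0 leading_coeff_0_iff nat.distinct(1))
    moreover have "coeff h (Suc (Suc m)) = 0"
      using f(2) by (simp add: coeff_eq_0)
    ultimately show ?thesis by (simp add: f(1) field_simps)
  qed
  ultimately show ?case
    using convex_average_step[OF assms(1) Suc.prems(2)[OF f(3)]] by (simp only:)
qed

text \<open>The formal degree \<open>m\<close> is a parameter separate from \<open>degree f\<close>,
  because the identity linking it to the apolarity form puts no bound on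
  \<open>degree f\<close>.\<close>

definition polar_deriv :: "nat \<Rightarrow> complex \<Rightarrow> complex poly \<Rightarrow> complex poly" where
  "polar_deriv m w f = smult (of_nat m) f + [:w, - 1:] * pderiv f"

lemma coeff_polar_deriv:
  "coeff (polar_deriv m w f) k
    = (of_nat m - of_nat k) * coeff f k + w * of_nat (Suc k) * coeff f (Suc k)"
proof (cases k)
  case 0
  then show ?thesis by (simp add: polar_deriv_def coeff_pderiv)
next
  case (Suc j)
  then show ?thesis
    by (simp add: polar_deriv_def coeff_pderiv coeff_pCons left_diff_distrib del: of_nat_Suc)
qed

text \<open>Both claims come from means. The coefficient of degree \<open>m\<close> vanishes only if
  \<open>w\<close> is the centroid of the roots, which lies in the convex set \<open>E\<close>. A
  root \<open>z\<close> outside \<open>E\<close> would make \<open>inverse (z - w)\<close> a mean of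
  the \<open>inverse (z - x)\<close> over the roots \<open>x\<close> of \<open>f\<close>, against
  the inversion lemma.\<close>

lemma laguerre:
  fixes B :: complex and A C :: real and strict :: bool
  defines "E \<equiv> quad_sublevel strict A B C"
  assumes A: "A \<ge> 0" and deg: "degree f = Suc m"
    and roots: "\<And>x. poly f x = 0 \<Longrightarrow> x \<in> E" and w: "w \<notin> E"
  shows "degree (polar_deriv (Suc m) w f) = m"
    and "poly (polar_deriv (Suc m) w f) z = 0 \<Longrightarrow> z \<in> E"
proof -
  have lc: "coeff f (Suc m) \<noteq> 0"
    using deg by (metis degree_0 leading_coeff_0_iff nat.distinct(1))
  have "- coeff f m / coeff f (Suc m) / of_nat (Suc m) \<in> E"
    using convex_quad_sublevel[OF A] deg roots unfolding E_def by (rule centroid_average)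
  then have "w \<noteq> - coeff f m / coeff f (Suc m) / of_nat (Suc m)"
    using w by blast
  then have "coeff f m + w * of_nat (Suc m) * coeff f (Suc m) \<noteq> 0"
    using lc by (auto simp: field_simps add_eq_0_iff simp del: of_nat_Suc)
  then have "coeff (polar_deriv (Suc m) w f) m \<noteq> 0"
    by (simp add: coeff_polar_deriv)
  \<comment> \<open>At \<open>k = Suc m\<close> the factor \<open>Suc m - k\<close> removes the
    leading coefficient of \<open>f\<close>.\<close>
  moreover have "coeff (polar_deriv (Suc m) w f) k = 0" if "k > m" for k
  proof (cases "k = Suc m")
    case True
    then show ?thesis using deg by (simp add: coeff_polar_deriv coeff_eq_0)
  next
    case False
    then show ?thesis using that deg by (simp add: coeff_polar_deriv coeff_eq_0)
  qed
  ultimately show "degree (polar_deriv (Suc m) w f) = m"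
    by (meson degree_le le_antisym le_degree)
  show "z \<in> E" if "poly (polar_deriv (Suc m) w f) z = 0"
  proof (rule ccontr)
    assume z: "z \<notin> E"
    then have fz: "poly f z \<noteq> 0" using roots by blast
    \<comment> \<open>Divided by \<open>poly f z\<close>, this equates the mean of the
      \<open>inverse (z - x)\<close> with \<open>inverse (z - w)\<close>.\<close>
    have eq: "of_nat (Suc m) * poly f z = (z - w) * poly (pderiv f) z"
      using that by (simp add: polar_deriv_def algebra_simps del: of_nat_Suc)
    have neq: "z \<noteq> w"
      using eq fz by (auto simp del: of_nat_Suc)
    have "poly (pderiv f) z / poly f z / of_nat (Suc m)
        \<in> convex hull ((\<lambda>x. inverse (z - x)) ` E)"
      using deg fz roots by (intro log_derivative_average) (auto intro: hull_inc)
    also have "poly (pderiv f) z / poly f z / of_nat (Suc m) = inverse (z - w)"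
    proof -
      have "of_nat (Suc m) * poly f z \<noteq> 0" using fz by (simp del: of_nat_Suc)
      moreover from this have "poly (pderiv f) z \<noteq> 0" using eq by auto
      moreover have "poly (pderiv f) z / poly f z / of_nat (Suc m)
          = poly (pderiv f) z / ((z - w) * poly (pderiv f) z)"
        by (simp add: mult.commute flip: eq del: of_nat_Suc)
      ultimately show ?thesis using neq by (simp add: field_simps)
    qed
    finally show False
      using inversion_hull_quad_sublevel[OF A] z w neq unfolding E_def by blast
  qed
qed

section \<open>Grace's theorem\<close>

text \<open>Reversing the summation order \<open>k\<close> to \<open>m - k\<close> costs only a
  sign; this lets the two polynomials change roles.\<close>

lemma apolarity_form_commute:
  "apolarity_form m g f = (- 1) ^ m * apolarity_form m f g"
proof -
  have "apolarity_form m g f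
      = (\<Sum>k\<le>m. (- 1) ^ (m - k) / of_nat (m choose (m - k)) * coeff g (m - k) * coeff f (m - (m - k)))"
    unfolding apolarity_form_def
    by (rule sum.reindex_bij_witness[of _ "\<lambda>k. m - k" "\<lambda>k. m - k"]) auto
  also have "\<dots> = (\<Sum>k\<le>m. (- 1) ^ m * ((- 1) ^ k / of_nat (m choose k) * coeff f k * coeff g (m - k)))"
  proof (rule sum.cong)
    fix k assume k: "k \<in> {..m}"
    then have "(- 1 :: complex) ^ (m - k) = (- 1) ^ m * (- 1) ^ k"
      by (simp add: minus_one_power_iff)
    then show "(- 1) ^ (m - k) / of_nat (m choose (m - k)) * coeff g (m - k) * coeff f (m - (m - k))
        = (- 1) ^ m * ((- 1) ^ k / of_nat (m choose k) * coeff f k * coeff g (m - k))"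
      using k binomial_symmetric[of k m] by simp
  qed simp
  finally show ?thesis by (simp add: apolarity_form_def sum_distrib_left)
qed

text \<open>Up to the factor \<open>1/(m+1)\<close>, multiplication by \<open>X - w\<close> is
  adjoint to the polar derivative with pole \<open>w\<close>; this is checked on the coefficient of
  each \<open>coeff g (m - k)\<close>.\<close>

lemma apolarity_form_linear_factor:
  assumes "degree g \<le> m"
  shows "apolarity_form (Suc m) f ([:- w, 1:] * g)
    = apolarity_form m (polar_deriv (Suc m) w f) g / of_nat (Suc m)"
proof -
  define c where "c k = (- 1) ^ k / of_nat (Suc m choose k) * coeff f k" for k
  \<comment> \<open>At \<open>k = Suc m\<close> truncated subtraction would yield
    \<open>coeff g 0\<close>, while the constant term of \<open>X * g\<close> is 0; hence the case
    distinction.\<close>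
  have "apolarity_form (Suc m) f ([:- w, 1:] * g)
      = (\<Sum>k\<le>Suc m. c k * (if k = Suc m then 0 else coeff g (m - k)))
        - (\<Sum>k\<le>Suc m. c k * w * coeff g (Suc m - k))"
    unfolding apolarity_form_def sum_subtractf[symmetric]
    by (intro sum.cong refl)
       (auto simp: c_def Suc_diff_le algebra_simps coeff_pCons split: nat.splits)
  also have "(\<Sum>k\<le>Suc m. c k * (if k = Suc m then 0 else coeff g (m - k)))
      = (\<Sum>k\<le>m. c k * coeff g (m - k))"
    by (auto intro!: sum.cong)
  \<comment> \<open>The term \<open>k = 0\<close> contains \<open>coeff g (Suc m)\<close>, which is
    0 by the degree bound.\<close>
  also have "(\<Sum>k\<le>Suc m. c k * w * coeff g (Suc m - k))
      = (\<Sum>k\<le>m. c (Suc k) * w * coeff g (m - k))"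
    using assms by (subst sum.atMost_Suc_shift) (simp add: coeff_eq_0)
  also have "(\<Sum>k\<le>m. c k * coeff g (m - k)) - (\<Sum>k\<le>m. c (Suc k) * w * coeff g (m - k))
      = (\<Sum>k\<le>m. (- 1) ^ k / of_nat (m choose k) * coeff (polar_deriv (Suc m) w f) k
           * coeff g (m - k) / of_nat (Suc m))"
    unfolding sum_subtractf[symmetric]
  proof (intro sum.cong refl)
    fix k assume k: "k \<in> {..m}"
    define b :: complex where "b = of_nat (m choose k)"
    have b: "b \<noteq> 0" using k by (simp add: b_def)
    \<comment> \<open>Two absorption identities express both binomials through
      \<open>m choose k\<close>; their factors are those in the polar derivative's
      coefficients.\<close>
    have "(Suc m - k) * (Suc m choose k) = Suc m * (m choose k)"
      using binomial_absorb_comp[of "Suc m" k] by simp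
    then have "of_nat (Suc m - k) * of_nat (Suc m choose k) = (of_nat (Suc m) * b :: complex)"
      unfolding b_def of_nat_mult[symmetric] by (rule arg_cong)
    then have 1: "of_nat (Suc m choose k) = of_nat (Suc m) * b / of_nat (Suc m - k)"
      using k by (simp add: field_simps del: of_nat_Suc)
    have "of_nat (Suc k) * of_nat (Suc m choose Suc k) = (of_nat (Suc m) * b :: complex)"
      unfolding b_def of_nat_mult[symmetric] using Suc_times_binomial[of k m] by (rule arg_cong)
    then have 2: "of_nat (Suc m choose Suc k) = of_nat (Suc m) * b / of_nat (Suc k)"
      by (simp add: field_simps del: of_nat_Suc binomial_Suc_Suc)
    have 3: "of_nat (Suc m) - of_nat k = (of_nat (Suc m - k) :: complex)"
      using k by (simp add: of_nat_diff)
    show "c k * coeff g (m - k) - c (Suc k) * w * coeff g (m - k)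
      = (- 1) ^ k / of_nat (m choose k) * coeff (polar_deriv (Suc m) w f) k
           * coeff g (m - k) / of_nat (Suc m)"
      unfolding c_def coeff_polar_deriv b_def[symmetric] 1 2 3
      using b by (simp add: field_simps del: of_nat_Suc)
  qed
  finally show ?thesis by (simp add: apolarity_form_def sum_divide_distrib del: of_nat_Suc)
qed

lemma grace:
  fixes E :: "complex set"
  assumes E: "disk_or_halfplane E"
    and "degree f = m" "degree g = m" "f \<noteq> 0" "g \<noteq> 0"
    and "\<And>x. poly f x = 0 \<Longrightarrow> x \<in> E" "\<And>x. poly g x = 0 \<Longrightarrow> x \<notin> E"
  shows "apolarity_form m f g \<noteq> 0"
proof -
  obtain strict A B C where A: "A \<ge> 0" and EQ: "E = quad_sublevel strict A B C"
    using disk_or_halfplane_quad_sublevel[OF E] .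
  show ?thesis
    using assms(2-)
  proof (induction m arbitrary: f g)
    case 0
    then show ?case by (auto simp: apolarity_form_def elim!: degree_eq_zeroE)
  next
    case (Suc m)
    obtain w h where g: "g = [:- w, 1:] * h" "degree h = m" "poly g w = 0"
      using complex_poly_split_root[OF Suc.prems(2)] .
    have w: "w \<notin> E" using Suc.prems(6) g(3) .
    note laguerre = laguerre[OF A Suc.prems(1), of strict B C w, folded EQ, OF Suc.prems(5) w]
    \<comment> \<open>If it were 0, then \<open>w\<close> would be a root and so lie in
      \<open>E\<close>. The degree alone does not exclude this when \<open>m = 0\<close>.\<close>
    have "polar_deriv (Suc m) w f \<noteq> 0"
      using laguerre(2)[of w] w by auto
    then have "apolarity_form m (polar_deriv (Suc m) w f) h \<noteq> 0"
      using Suc.prems(4,6) g laguerre by (intro Suc.IH) auto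
    then show ?case
      using apolarity_form_linear_factor[of h m f w] g by (simp del: of_nat_Suc)
  qed
qed

section \<open>Reduction to Grace's theorem by composition with \<open>q\<close>\<close>

theorem theorem3p5:
  fixes D :: "complex set" and q f g :: "complex poly" and d n :: nat
  assumes "circular_domain D"
    and "lead_coeff q = 1" and "degree q = d"
    and "degree f = n" and "degree g = n"
    and "q_apolar n q f g"
    and "{z. poly f z = 0} \<subseteq> inner_image q D"
  shows "\<exists>z. poly g z = 0 \<and> z \<in> poly q ` D"
proof (rule ccontr)
  assume no_root: "\<not> ?thesis"
  define F G where "F = pcompose f q" and "G = pcompose g q"
  have F: "x \<in> D" if "poly F x = 0" for x
    using that assms(7) by (auto simp: F_def poly_pcompose inner_image_def)
  have G: "x \<notin> D" if "poly G x = 0" for x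
    using that no_root by (auto simp: G_def poly_pcompose)
  \<comment> \<open>\<open>F = 0\<close> would force \<open>D = UNIV\<close>, and
    \<open>G = 0\<close> would force \<open>D = {}\<close>.\<close>
  have "F \<noteq> 0" "G \<noteq> 0"
    using F G circular_domain_proper[OF assms(1)] by fastforce+
  moreover have "degree F = n * d" "degree G = n * d"
    using assms(3-5) by (simp_all add: F_def G_def degree_pcompose)
  moreover obtain E where E: "disk_or_halfplane E" "D = E \<or> D = - E"
    using assms(1) unfolding circular_domain_def by blast
  \<comment> \<open>If \<open>D = - E\<close>, the roots of \<open>G\<close> lie in \<open>E\<close>
    and those of \<open>F\<close> outside, so \<open>G\<close> comes first.\<close>
  ultimately have "apolarity_form (n * d) F G \<noteq> 0 \<or> apolarity_form (n * d) G F \<noteq> 0"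
    using grace[OF E(1), of F "n * d" G] grace[OF E(1), of G "n * d" F] F G by blast
  then have "apolarity_form (n * d) F G \<noteq> 0"
    by (auto simp: apolarity_form_commute[of _ G F])
  with assms(3,6) show False
    by (simp add: q_apolar_def F_def G_def)
qed

end
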